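(* For every prime $p>2$, \[ \sum_{n=0}^{p-1} \frac{92n^2+61n+9}{2^{6n}(2n+1)}\binom{4n}{2n}\binom{3n}{n}\binom{2n}{n} \equiv 0 \pmod{p}. \]
   Context: For rational numbers $x,y$ and a prime $p$, $x\equiv y\pmod{p^r}$ means that $x-y$ is a rational number whose $p$-adic valuation is at least $r$. *)

theory Defs
  imports Complex_Main "HOL-Computational_Algebra.Primes"
begin

text \<open>The \<open>p\<close>-adic valuation of a nonzero rational number. At \<open>0\<close> the value is a dummy,
  the mathematical value being \<open>\<infinity>\<close>; the congruence below treats that case separately.\<close>

definition padic_val :: "nat \<Rightarrow> rat \<Rightarrow> int" where
  "padic_val p x =
     int (multiplicity (int p) (fst (quotient_of x))) -
     int (multiplicity (int p) (snd (quotient_of x)))"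

text \<open>\<open>rat_cong_pow p r x y\<close> is \<open>x \<equiv> y (mod p\<^sup>r)\<close>. Neither side needs to be \<open>p\<close>-integral.\<close>

definition rat_cong_pow :: "nat \<Rightarrow> nat \<Rightarrow> rat \<Rightarrow> rat \<Rightarrow> bool" where
  "rat_cong_pow p r x y \<longleftrightarrow> x - y = 0 \<or> padic_val p (x - y) \<ge> int r"

end

theory Submission imports Defs "HOL-Number_Theory.Cong" begin

text \<open>
  Write \<open>p = 2 m + 1\<close>. Modulo \<open>p\<close> one has \<open>binom(2j, j) \<equiv> (-4)\<^sup>j binom(m, j)\<close>, which turns the
  terms with \<open>n < m\<close> into the terms of a terminating sum that vanishes over the integers. This
  vanishing comes from a Wilf-Zeilberger pair: normalising the summand of Gauss's theorem for
  \<open>\<^sub>2F\<^sub>1(-m, b; 1; 1)\<close>, at \<open>b = n\<close> and summation index \<open>K\<close>, gives \<open>gauss_term m n K\<close>, and the sum is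
  taken along the line \<open>K = 2 n\<close>. Translating the line to \<open>K = 2 n + k\<close> does not change the sum,
  and for \<open>k > m\<close> all the terms are zero. In the terms with \<open>n \<ge> m\<close> the binomial coefficients
  contain enough factors \<open>p\<close>.
\<close>

section \<open>The Wilf-Zeilberger pair\<close>

text \<open>The factor \<open>int n\<close> makes the row n = 0 vanish, whatever the truncated
  \<open>n - 1\<close> gives there; this is the lower boundary value in the telescoping.\<close>

definition gauss_term :: "nat \<Rightarrow> nat \<Rightarrow> nat \<Rightarrow> int" where
  "gauss_term m n K = (-1) ^ (n + K) * int (m choose K) * int (m choose n)
     * (int n * int ((n + K - 1) choose (n - 1)))"

text \<open>By the symmetry of binomial coefficients this is \<open>gauss_term\<close> with n and K
  exchanged.\<close>

definition gauss_mate :: "nat \<Rightarrow> nat \<Rightarrow> nat \<Rightarrow> int" where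
  "gauss_mate m n K = (-1) ^ (n + K) * int (m choose K) * int (m choose n)
     * (int K * int ((n + K - 1) choose n))"

lemma Suc_times_choose_Suc_int:
  "int (Suc k) * int (m choose Suc k) = (int m - int k) * int (m choose k)"
proof (cases "k \<le> m")
  case True
  then show ?thesis
    by (metis binomial_absorb_comp binomial_absorption of_nat_diff of_nat_mult)
next
  case False
  then show ?thesis by (simp add: binomial_eq_0)
qed

text \<open>With a and b the two coefficients on the left, Pascal's rule turns the right side into
  (n - K)(a + b), and the cross terms cancel because n b = K a.\<close>

lemma binomial_weighted_diff:
  "int n * int ((n + K - 1) choose (n - 1)) - int K * int ((n + K - 1) choose n)
     = (int n - int K) * int ((n + K) choose n)"
proof (cases n)
  case 0
  then show ?thesis by simp
next
  case (Suc l)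
  have pascal: "int ((n + K) choose n) = int ((n + K - 1) choose (n - 1)) + int ((n + K - 1) choose n)"
    using Suc by simp
  have "int n * int ((n + K - 1) choose n) = int K * int ((n + K - 1) choose (n - 1))"
    using Suc Suc_times_choose_Suc_int[of l "l + K"] by simp
  then show ?thesis
    unfolding pascal by (simp add: algebra_simps)
qed

text \<open>Absorption makes both shifted entries multiples of \<open>(n + K) choose n\<close>, with
  factors m - n and m - K. In their difference m drops out, and what remains is
  \<open>binomial_weighted_diff\<close>.\<close>

lemma gauss_pair:
  "gauss_term m (Suc n) K - gauss_term m n K = gauss_mate m n (Suc K) - gauss_mate m n K"
proof -
  define s where "s = (-1 :: int) ^ (n + K)"
  define X where "X = int ((n + K) choose n)"
  have t1: "gauss_term m (Suc n) K = - s * int (m choose K) * ((int m - int n) * int (m choose n)) * X"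
    unfolding Suc_times_choose_Suc_int[symmetric]
    by (simp add: gauss_term_def s_def X_def mult_ac del: of_nat_Suc)
  have t2: "gauss_mate m n (Suc K) = - s * int (m choose n) * ((int m - int K) * int (m choose K)) * X"
    unfolding Suc_times_choose_Suc_int[symmetric]
    by (simp add: gauss_mate_def s_def X_def mult_ac del: of_nat_Suc)
  have t3: "gauss_term m n K - gauss_mate m n K
      = s * int (m choose K) * int (m choose n) * ((int n - int K) * X)"
    unfolding gauss_term_def gauss_mate_def X_def binomial_weighted_diff[symmetric]
    by (simp add: s_def algebra_simps)
  show ?thesis
    using t3 unfolding t1 t2 by (simp add: algebra_simps)
qed

section \<open>Summation along a line\<close>

text \<open>Weight of the lattice path from (n, 2n + k) to (n + 1, 2n + k + 2): one step in n,
  weighted by \<open>gauss_mate\<close>, then two steps in K, weighted by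
  \<open>gauss_term\<close>.\<close>

definition line_term :: "nat \<Rightarrow> nat \<Rightarrow> nat \<Rightarrow> int" where
  "line_term m k n = gauss_term m (Suc n) (2 * n + k) + gauss_term m (Suc n) (Suc (2 * n + k))
     + gauss_mate m n (2 * n + k)"

lemma line_term_shift:
  "line_term m (Suc k) n - line_term m k n
     = gauss_term m (Suc n) (2 * Suc n + k) - gauss_term m n (2 * n + k)"
  using gauss_pair[of m n "2 * n + k"] by (simp add: line_term_def)

lemma sum_line_term_eq_0: "(\<Sum>n<Suc m. line_term m k n) = 0"
proof -
  have shift: "(\<Sum>n<Suc m. line_term m (Suc k) n) = (\<Sum>n<Suc m. line_term m k n)" for k
  proof -
    have "(\<Sum>n<Suc m. line_term m (Suc k) n) - (\<Sum>n<Suc m. line_term m k n)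
        = (\<Sum>n<Suc m. gauss_term m (Suc n) (2 * Suc n + k) - gauss_term m n (2 * n + k))"
      by (simp only: sum_subtractf[symmetric] line_term_shift)
    also have "\<dots> = gauss_term m (Suc m) (2 * Suc m + k) - gauss_term m 0 (2 * 0 + k)"
      by (rule sum_lessThan_telescope)
    \<comment> \<open>The upper end contains \<open>m choose Suc m\<close>, the lower end the factor
      n = 0.\<close>
    also have "\<dots> = 0"
      by (simp add: gauss_term_def)
    finally show ?thesis by simp
  qed
  have "(\<Sum>n<Suc m. line_term m k n) = (\<Sum>n<Suc m. line_term m (k + j) n)" for j
    by (induction j) (simp_all only: add_Suc_right shift add_0_right)
  \<comment> \<open>After m + 1 shifts every K on the line exceeds m.\<close>
  moreover have "line_term m (k + Suc m) n = 0" for n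
    by (simp add: line_term_def gauss_term_def gauss_mate_def binomial_eq_0)
  ultimately show ?thesis
    by (metis (no_types, lifting) sum.neutral)
qed

lemma line_term_eq_0: "m < 2 * n \<Longrightarrow> line_term m 0 n = 0"
  by (simp add: line_term_def gauss_term_def gauss_mate_def binomial_eq_0)

text \<open>Each of the ratios C'/C and X'/X has denominator 2n + 1, and comparing Y with X costs a
  factor 3; the factor on the left clears all three.\<close>

lemma line_term_closed_form:
  "3 * (2 * int n + 1)\<^sup>2 * line_term m 0 n
     = (-1) ^ n * int (m choose n) * int (m choose (2 * n)) * int ((3 * n) choose n)
       * (4 * int n * (2 * int n + 1)\<^sup>2
          - 3 * (int m - int n) * ((2 * int n + 1)\<^sup>2 + (2 * int n - int m) * (3 * int n + 1)))"
proof -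
  define s where "s = (-1 :: int) ^ n"
  define M where "M = int (m choose n)"
  define C where "C = int (m choose (2 * n))"
  define C' where "C' = int (m choose (Suc (2 * n)))"
  define X where "X = int ((3 * n) choose n)"
  define X' where "X' = int ((3 * n + 1) choose n)"
  define Y where "Y = int ((3 * n - 1) choose n)"
  have M: "int (Suc n) * int (m choose Suc n) = (int m - int n) * M"
    unfolding M_def by (rule Suc_times_choose_Suc_int)
  have C': "(2 * int n + 1) * C' = (int m - 2 * int n) * C"
    using Suc_times_choose_Suc_int[of "2 * n" m] by (simp add: C_def C'_def algebra_simps)
  have X': "(2 * int n + 1) * X' = (3 * int n + 1) * X"
  proof -
    have "(Suc (2 * n)) * ((3 * n + 1) choose (2 * n + 1)) = (3 * n + 1) * ((3 * n) choose (2 * n))"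
      using Suc_times_binomial[of "2 * n" "3 * n"] by simp
    moreover have "(3 * n + 1) choose (2 * n + 1) = (3 * n + 1) choose n"
      using binomial_symmetric[of n "3 * n + 1"] by simp
    moreover have "(3 * n) choose (2 * n) = (3 * n) choose n"
      using binomial_symmetric[of n "3 * n"] by simp
    ultimately have "Suc (2 * n) * ((3 * n + 1) choose n) = (3 * n + 1) * ((3 * n) choose n)"
      by (simp only:)
    then have "int (Suc (2 * n) * ((3 * n + 1) choose n)) = int ((3 * n + 1) * ((3 * n) choose n))"
      by (simp only:)
    then show ?thesis by (simp add: X_def X'_def algebra_simps)
  qed
  \<comment> \<open>The factor n stays on both sides: for n = 0 truncation gives Y = X = 1, and 3 Y
    = 2 X fails.\<close>
  have Y: "3 * (2 * int n * Y) = 4 * int n * X"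
  proof -
    have "3 * n - n = 2 * n" by simp
    then have "2 * n * ((3 * n) choose n) = 3 * n * ((3 * n - 1) choose n)"
      using binomial_absorb_comp[of "3 * n" n] by (simp only:)
    then have "int (2 * n * ((3 * n) choose n)) = int (3 * n * ((3 * n - 1) choose n))"
      by (simp only:)
    then show ?thesis by (simp only: X_def Y_def of_nat_mult of_nat_numeral)
  qed
  have sgn: "(-1 :: int) ^ (n * 3) = s"
    by (simp add: s_def power_mult mult.commute[of n])
  have L: "line_term m 0 n
      = s * M * ((int m - int n) * (C' * X' - C * X) + C * (2 * int n * Y))"
  proof -
    have a: "gauss_term m (Suc n) (2 * n) = - s * C * ((int m - int n) * M) * X"
      unfolding M[symmetric] by (simp add: gauss_term_def sgn C_def X_def mult_ac del: of_nat_Suc)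
    have b: "gauss_term m (Suc n) (Suc (2 * n)) = s * C' * ((int m - int n) * M) * X'"
      unfolding M[symmetric] by (simp add: gauss_term_def sgn C'_def X'_def mult_ac del: of_nat_Suc)
    have c: "gauss_mate m n (2 * n) = s * C * M * (2 * int n * Y)"
      by (simp add: gauss_mate_def sgn C_def M_def Y_def mult_ac)
    show ?thesis
      unfolding line_term_def add_0_right a b c by (simp add: algebra_simps)
  qed
  define q where "q = 2 * int n + 1"
  have CX: "q\<^sup>2 * (C' * X') = (int m - 2 * int n) * C * ((3 * int n + 1) * X)"
    unfolding C'[symmetric] X'[symmetric] q_def by (simp add: power2_eq_square algebra_simps)
  have "3 * q\<^sup>2 * line_term m 0 n
      = s * M * (3 * (int m - int n) * (q\<^sup>2 * (C' * X') - q\<^sup>2 * (C * X)) + C * q\<^sup>2 * (3 * (2 * int n * Y)))"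
    unfolding L by (simp add: algebra_simps)
  also have "\<dots> = s * M * C * X
      * (4 * int n * q\<^sup>2 - 3 * (int m - int n) * (q\<^sup>2 + (2 * int n - int m) * (3 * int n + 1)))"
    unfolding CX Y by (simp add: algebra_simps)
  finally show ?thesis
    by (simp add: q_def s_def M_def C_def X_def)
qed

section \<open>Binomial coefficients modulo p\<close>

lemma coprime_int_prime:
  fixes p n :: nat
  assumes "prime p" "0 < n" "n < p"
  shows "coprime (int n) (int p)"
  using assms by (metis coprime_commute coprime_int_iff nat_dvd_not_less prime_imp_coprime)

text \<open>The left side is (-4)^j binom(-1/2, j), and m \<equiv> -1/2 modulo p. The induction
  compares the recurrences in j and cancels j + 1, which is invertible below p.\<close>

lemma central_binomial_cong:
  fixes p m :: nat
  assumes "prime p" "p = 2 * m + 1" "j < p"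
  shows "[int ((2 * j) choose j) = (-4) ^ j * int (m choose j)] (mod int p)"
  using assms(3)
proof (induction j)
  case 0
  then show ?case by simp
next
  case (Suc j)
  have rec: "int (Suc j) * int ((2 * Suc j) choose Suc j) = 2 * (2 * int j + 1) * int ((2 * j) choose j)"
  proof -
    have "Suc j * ((2 * Suc j) choose Suc j) = 2 * (Suc j * ((2 * j + 1) choose Suc j))"
      using binomial_symmetric[of j "2 * j + 1"] by (simp add: algebra_simps)
    also have "\<dots> = 2 * ((2 * j + 1) * ((2 * j) choose j))"
      using Suc_times_binomial[of j "2 * j"] by simp
    finally have "int (Suc j * ((2 * Suc j) choose Suc j)) = int (2 * ((2 * j + 1) * ((2 * j) choose j)))"
      by (rule arg_cong)
    then show ?thesis
      by (simp only: of_nat_mult of_nat_add of_nat_numeral of_nat_1 mult.assoc)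
  qed
  have "[2 * (2 * int j + 1) * int ((2 * j) choose j)
      = (-4 * (int m - int j)) * ((-4) ^ j * int (m choose j))] (mod int p)"
  proof (rule cong_mult)
    \<comment> \<open>The difference is 4m + 2 = 2p, whence the witness 2.\<close>
    show "[2 * (2 * int j + 1) = -4 * (int m - int j)] (mod int p)"
      using assms(2) by (simp add: cong_iff_dvd_diff) (rule dvdI[of _ _ 2], simp)
    show "[int ((2 * j) choose j) = (-4) ^ j * int (m choose j)] (mod int p)"
      using Suc by simp
  qed
  also have "(-4 * (int m - int j)) * ((-4) ^ j * int (m choose j))
      = int (Suc j) * ((-4) ^ Suc j * int (m choose Suc j))"
    unfolding mult.left_commute[of "int (Suc j)"] Suc_times_choose_Suc_int
    by (simp only: power_Suc mult_ac)
  finally have "[int (Suc j) * int ((2 * Suc j) choose Suc j)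
      = int (Suc j) * ((-4) ^ Suc j * int (m choose Suc j))] (mod int p)"
    unfolding rec .
  moreover have "coprime (int (Suc j)) (int p)"
    using coprime_int_prime[OF assms(1), of "Suc j"] Suc.prems by simp
  ultimately show ?case
    by (simp only: cong_mult_lcancel)
qed

text \<open>The prime divides (a + b)! but neither a! nor b!.\<close>

lemma prime_dvd_binomial_carry:
  fixes p a b :: nat
  assumes "prime p" "a < p" "b < p" "p \<le> a + b"
  shows "p dvd ((a + b) choose a)"
proof -
  have "p dvd fact (a + b)"
    using assms by (simp add: prime_dvd_fact_iff)
  then have "p dvd fact a * fact b * ((a + b) choose a)"
    using binomial_fact_lemma[of a "a + b"] by simp
  then show ?thesis
    using assms by (simp add: prime_dvd_mult_iff prime_dvd_fact_iff)
qed

section \<open>Rationals divisible by p\<close>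

text \<open>The maximal ideal of the integers localised at p. The fractions need not be reduced, so
  sums can be formed without passing to lowest terms.\<close>

definition prime_multiple :: "nat \<Rightarrow> rat \<Rightarrow> bool" where
  "prime_multiple p x \<longleftrightarrow> (\<exists>a b. \<not> int p dvd b \<and> x = of_int (int p * a) / of_int b)"

lemma prime_multiple_add:
  assumes "prime p" "prime_multiple p x" "prime_multiple p y"
  shows "prime_multiple p (x + y)"
proof -
  obtain a b c d where *: "\<not> int p dvd b" "x = of_int (int p * a) / of_int b"
    "\<not> int p dvd d" "y = of_int (int p * c) / of_int d"
    using assms(2,3) unfolding prime_multiple_def by blast
  then have "b \<noteq> 0" "d \<noteq> 0" by auto
  then have "x + y = of_int (int p * (a * d + c * b)) / of_int (b * d)"
    using * by (simp add: field_simps)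
  moreover have "\<not> int p dvd b * d"
    using * assms(1) by (simp add: prime_dvd_mult_iff)
  ultimately show ?thesis
    unfolding prime_multiple_def by blast
qed

lemma prime_multiple_sum:
  assumes "prime p" "\<And>i. i \<in> A \<Longrightarrow> prime_multiple p (f i)"
  shows "prime_multiple p (sum f A)"
proof -
  have "\<not> int p dvd 1"
    using prime_gt_1_nat[OF assms(1)] by simp
  then have zero: "prime_multiple p 0"
    unfolding prime_multiple_def by (intro exI[of _ 0] exI[of _ 1]) simp
  show ?thesis
    using assms(2)
    by (induction A rule: infinite_finite_induct) (simp_all add: zero prime_multiple_add[OF assms(1)])
qed

text \<open>Cross-multiplication with the reduced fraction c/d forces p into c, and coprimality
  keeps it out of d.\<close>

lemma prime_multiple_imp_rat_cong:
  assumes "prime p" "prime_multiple p x"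
  shows "rat_cong_pow p 1 x 0"
proof (cases "x = 0")
  case True
  then show ?thesis by (simp add: rat_cong_pow_def)
next
  case False
  obtain a b where ab: "\<not> int p dvd b" "x = of_int (int p * a) / of_int b"
    using assms(2) unfolding prime_multiple_def by blast
  obtain c d where cd: "quotient_of x = (c, d)" by force
  have x: "x = of_int c / of_int d" and d: "d > 0" and cop: "coprime c d"
    using cd quotient_of_div quotient_of_denom_pos quotient_of_coprime by blast+
  have "b \<noteq> 0" using ab by auto
  then have "(of_int (c * b) :: rat) = of_int (int p * a * d)"
    using ab(2) x d by (simp add: field_simps)
  then have "c * b = int p * a * d" by (simp only: of_int_eq_iff)
  then have "int p dvd c * b" by simp
  then have pc: "int p dvd c"
    using ab(1) assms(1) by (simp add: prime_dvd_mult_iff)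
  have "\<not> int p dvd d"
    using pc cop assms(1) by (metis not_coprimeI not_prime_unit prime_nat_int_transfer)
  moreover have "multiplicity (int p) c \<ge> 1"
    using pc False x assms(1) by (intro multiplicity_geI) auto
  ultimately show ?thesis
    using cd by (simp add: rat_cong_pow_def padic_val_def not_dvd_imp_multiplicity_0)
qed

section \<open>The summand modulo p\<close>

text \<open>For n < m the closed form matches the summand modulo p. For n \<ge> m the line term is
  zero and carries make the summand divisible by p. The constant 12 is 3 from the closed form times
  4 from clearing halves in m \<equiv> -1/2.\<close>

lemma summand_prime_multiple:
  fixes p m n :: nat
  assumes p: "prime p" and m: "p = 2 * m + 1" "m > 0" and n: "n < p"
  shows "prime_multiple p
    ((92 * of_nat n ^ 2 + 61 * of_nat n + 9) / (2 ^ (6 * n) * (2 * of_nat n + 1))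
         * of_nat ((4 * n) choose (2 * n)) * of_nat ((3 * n) choose n)
         * of_nat ((2 * n) choose n)
      - of_int (12 * line_term m 0 n))" (is "prime_multiple p (?w - _)")
proof -
  define B where "B = int ((4 * n) choose (2 * n)) * int ((3 * n) choose n) * int ((2 * n) choose n)"
  define r where "r = 92 * (int n)\<^sup>2 + 61 * int n + 9"
  define q where "q = 2 * int n + 1"
  have w: "?w = of_int (r * B) / of_int (64 ^ n * q)"
    by (simp add: r_def B_def q_def power_mult)
  have q: "q \<noteq> 0" by (simp add: q_def)
  have p64: "\<not> int p dvd 64 ^ n"
  proof
    assume "int p dvd 64 ^ n"
    then have "int p dvd 2 ^ (6 * n)" by (simp add: power_mult)
    then have "int p dvd 2"
      using p prime_dvd_power by (metis prime_nat_int_transfer)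
    then have "p dvd 2" by presburger
    then show False using m by (auto dest: dvd_imp_le)
  qed
  \<comment> \<open>As 0 < 2n + 1 < 2p, the only possible multiple of p is p itself, reached at n =
    m.\<close>
  have p_odd: "\<not> int p dvd q" if "n \<noteq> m"
  proof
    assume "int p dvd q"
    then have "p dvd 2 * n + 1"
      unfolding q_def by presburger
    then obtain c where c: "2 * n + 1 = p * c" by auto
    have "c < 2"
    proof (rule ccontr)
      assume "\<not> c < 2"
      then have "p * 2 \<le> p * c" by simp
      then show False using c n by linarith
    qed
    then have "c = 0 \<or> c = 1" by auto
    then show False using c m that by auto
  qed
  consider "n < m" | "n = m" | "m < n" by linarith
  then show ?thesis
  proof cases
    case 1
    define T where "T = line_term m 0 n"
    define D where "D = (-1) ^ n * int (m choose n) * int (m choose (2 * n)) * int ((3 * n) choose n)"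
    have B: "[B = 64 ^ n * D] (mod int p)"
    proof -
      have "[B = ((-4) ^ (2 * n) * int (m choose (2 * n))) * int ((3 * n) choose n)
          * ((-4) ^ n * int (m choose n))] (mod int p)"
        unfolding B_def
        using central_binomial_cong[OF p m(1), of "2 * n"] central_binomial_cong[OF p m(1), of n]
          1 m by (intro cong_mult cong_refl) simp_all
      also have "((-4) ^ (2 * n) * int (m choose (2 * n))) * int ((3 * n) choose n)
          * ((-4) ^ n * int (m choose n)) = 64 ^ n * D"
      proof -
        have "(-4 :: int) ^ (2 * n) * (-4) ^ n = 64 ^ n * (-1) ^ n"
          by (simp add: power_mult flip: power_mult_distrib)
        moreover have "((-4) ^ (2 * n) * int (m choose (2 * n))) * int ((3 * n) choose n)
            * ((-4) ^ n * int (m choose n))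
          = ((-4) ^ (2 * n) * (-4) ^ n)
            * (int (m choose n) * int (m choose (2 * n)) * int ((3 * n) choose n))"
          by (simp only: mult_ac)
        ultimately show ?thesis unfolding D_def by (simp only: mult.assoc)
      qed
      finally show ?thesis .
    qed
    \<comment> \<open>The polynomial 92n^2 + 61n + 9 arises here: the bracket is quadratic in m, so
      the factor 4 lets 2m be replaced by p - 1, and a factor q splits off modulo p.\<close>
    have P: "[4 * (4 * int n * q\<^sup>2 - 3 * (int m - int n) * (q\<^sup>2 + (2 * int n - int m) * (3 * int n + 1)))
        = q * r] (mod int p)"
    proof -
      have m2: "2 * int m = int p - 1" using m by simp
      have "4 * (4 * int n * q\<^sup>2 - 3 * (int m - int n) * (q\<^sup>2 + (2 * int n - int m) * (3 * int n + 1)))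
        = 16 * int n * q\<^sup>2 - 3 * (2 * int m - 2 * int n) * (2 * q\<^sup>2 + (4 * int n - 2 * int m) * (3 * int n + 1))"
        by (simp add: algebra_simps)
      also have "\<dots> = q * r + int p * (- 3 * (2 * q\<^sup>2 + (4 * int n + 1 - int p) * (3 * int n + 1))
          - 3 * q * (3 * int n + 1))"
        unfolding m2 by (simp add: q_def r_def power2_eq_square algebra_simps)
      finally show ?thesis by (simp add: cong_iff_dvd_diff)
    qed
    have closed: "3 * q\<^sup>2 * T = D * (4 * int n * q\<^sup>2
        - 3 * (int m - int n) * (q\<^sup>2 + (2 * int n - int m) * (3 * int n + 1)))"
      unfolding T_def q_def D_def by (rule line_term_closed_form)
    \<comment> \<open>The extra q supplies the factor in P; it is cancelled afterwards, being prime
      to p for n < m.\<close>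
    have "[q * (r * B) = (q * r) * (64 ^ n * D)] (mod int p)"
      using cong_scalar_left[OF B, of "q * r"] by (simp add: mult_ac)
    also have "[(q * r) * (64 ^ n * D) = (4 * (4 * int n * q\<^sup>2
        - 3 * (int m - int n) * (q\<^sup>2 + (2 * int n - int m) * (3 * int n + 1)))) * (64 ^ n * D)] (mod int p)"
      by (intro cong_mult cong_refl cong_sym[OF P])
    also have "(4 * (4 * int n * q\<^sup>2
        - 3 * (int m - int n) * (q\<^sup>2 + (2 * int n - int m) * (3 * int n + 1)))) * (64 ^ n * D)
      = 4 * 64 ^ n * (3 * q\<^sup>2 * T)"
      unfolding closed by (simp only: mult_ac)
    also have "\<dots> = q * (12 * T * (64 ^ n * q))"
      by (simp add: power2_eq_square)
    finally have "[q * (r * B) = q * (12 * T * (64 ^ n * q))] (mod int p)" .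
    moreover have "coprime q (int p)"
      using coprime_int_prime[OF p, of "2 * n + 1"] 1 m by (simp add: q_def add.commute)
    ultimately have "[r * B = 12 * T * (64 ^ n * q)] (mod int p)"
      by (simp only: cong_mult_lcancel)
    then obtain z where z: "r * B - 12 * T * (64 ^ n * q) = int p * z"
      by (auto simp: cong_iff_dvd_diff)
    have "?w - of_int (12 * T) = of_int (r * B - 12 * T * (64 ^ n * q)) / of_int (64 ^ n * q)"
      unfolding w using q by (simp add: field_simps)
    then have "?w - of_int (12 * T) = of_int (int p * z) / of_int (64 ^ n * q)"
      by (simp only: z)
    moreover have "\<not> int p dvd 64 ^ n * q"
      using p64 p_odd 1 p by (simp add: prime_dvd_mult_iff)
    ultimately show ?thesis
      unfolding prime_multiple_def T_def[symmetric] by (intro exI conjI)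
  next
    case 2
    \<comment> \<open>Here the denominator contains q = p, so two factors p are required; these two
      binomials give one each.\<close>
    have "4 * n = 2 * n + 2 * n" "3 * n = n + 2 * n" by simp_all
    then have "p dvd ((4 * n) choose (2 * n))" "p dvd ((3 * n) choose n)"
      using prime_dvd_binomial_carry[OF p, of "2 * n" "2 * n"]
        prime_dvd_binomial_carry[OF p, of n "2 * n"] 2 m by simp_all
    then have "int p * int p dvd B"
      unfolding B_def by (intro dvd_mult2 mult_dvd_mono) (simp_all only: int_dvd_int_iff)
    then obtain z where z: "B = int p * int p * z" by (elim dvdE)
    have "q = int p" using 2 m by (simp add: q_def)
    moreover have "line_term m 0 n = 0"
      using 2 m by (intro line_term_eq_0) simp
    ultimately have "?w - of_int (12 * line_term m 0 n) = of_int (int p * (r * z)) / of_int (64 ^ n)"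
      unfolding w z using prime_gt_0_nat[OF p] by simp
    then show ?thesis
      unfolding prime_multiple_def using p64 by blast
  next
    case 3
    have "p dvd ((2 * n) choose n)"
      using prime_dvd_binomial_carry[OF p n n] 3 m by (simp flip: mult_2)
    then have "int p dvd B"
      unfolding B_def by (intro dvd_mult) (simp only: int_dvd_int_iff)
    then obtain z where z: "B = int p * z" by (elim dvdE)
    have "line_term m 0 n = 0"
      using 3 by (intro line_term_eq_0) simp
    then have "?w - of_int (12 * line_term m 0 n) = of_int (int p * (r * z)) / of_int (64 ^ n * q)"
      unfolding w z by (simp add: mult_ac)
    moreover have "\<not> int p dvd 64 ^ n * q"
      using p64 p_odd 3 p by (simp add: prime_dvd_mult_iff)
    ultimately show ?thesis
      unfolding prime_multiple_def by blast
  qed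
qed

theorem theorem4:
  fixes p :: nat
  assumes "prime p" and "p > 2"
  shows "rat_cong_pow p 1
    (\<Sum>n = 0..p - 1.
       (92 * of_nat n ^ 2 + 61 * of_nat n + 9) / (2 ^ (6 * n) * (2 * of_nat n + 1))
         * of_nat ((4 * n) choose (2 * n)) * of_nat ((3 * n) choose n)
         * of_nat ((2 * n) choose n))
    0"
  (is "rat_cong_pow p 1 (\<Sum>n = 0..p - 1. ?w n) 0")
proof -
  have "odd p" using assms by (simp add: prime_odd_nat)
  then obtain m where m: "p = 2 * m + 1" by (elim oddE)
  have m0: "m > 0" using m assms by simp
  \<comment> \<open>The range up to p - 1 = 2m adds only indices n > m, where the line term
    vanishes.\<close>
  have "(\<Sum>n = 0..p - 1. line_term m 0 n) = (\<Sum>n<Suc m. line_term m 0 n)"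
    using m line_term_eq_0 by (intro sum.mono_neutral_right) auto
  also have "\<dots> = 0" by (rule sum_line_term_eq_0)
  finally have "(\<Sum>n = 0..p - 1. of_int (12 * line_term m 0 n) :: rat) = 0"
    by (simp only: of_int_sum[symmetric] sum_distrib_left[symmetric] mult_zero_right of_int_0)
  then have "(\<Sum>n = 0..p - 1. ?w n) = (\<Sum>n = 0..p - 1. ?w n - of_int (12 * line_term m 0 n))"
    by (simp only: sum_subtractf diff_zero)
  moreover have "prime_multiple p (\<Sum>n = 0..p - 1. ?w n - of_int (12 * line_term m 0 n))"
    using m by (intro prime_multiple_sum assms(1) summand_prime_multiple[OF assms(1) m m0]) simp
  ultimately show ?thesis
    by (simp only: prime_multiple_imp_rat_cong[OF assms(1)])
qed

end
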